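(* Let $F$ be an algebraically closed field of characteristic different from $2$. There exist simple commutative algebras over $F$ (not necessarily unital) that contain a nontrivial idempotent and are not isotopically simple.
   Context: An algebra over $F$ is a vector space with a bilinear multiplication (not necessarily associative). An algebra is simple if its multiplication is nonzero and it has no ideals other than $0$ and itself. An idempotent is an element $e$ with $e^2=e$; it is nontrivial if it is neither $0$ nor an identity element of the algebra. Algebras $(A,\cdot)$ and $(B,\circ)$ are isotopic (and $B$ is called an isotope of $A$) if there are linear isomorphisms $\varphi,\psi,\xi:A\to B$ with $\varphi(a)\circ\psi(b)=\xi(a\cdot b)$ for all $a,b\in A$. An algebra is isotopically simple if every isotope of it is a simple algebra. *)

theory Defs
  imports "HOL-Algebra.Algebra"
begin

definition ring_char :: "('a, 'm) ring_scheme \<Rightarrow> nat" where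
  "ring_char R =
     (if \<exists>n::nat. n > 0 \<and> [n] \<cdot>\<^bsub>R\<^esub> \<one>\<^bsub>R\<^esub> = \<zero>\<^bsub>R\<^esub>
      then (LEAST n::nat. n > 0 \<and> [n] \<cdot>\<^bsub>R\<^esub> \<one>\<^bsub>R\<^esub> = \<zero>\<^bsub>R\<^esub>)
      else 0)"

(* The record type module supplies addition, scalar multiplication and the product.
   It also has a field for a unit; as algebras need not be unital, no definition below
   refers to one of A, whose value is irrelevant.  The library locale algebra
   requires an associative commutative unital product, so it does not apply here. *)
locale nonassoc_algebra = field F + module F A
  for F (structure) and A (structure) +
  assumes mult_closed:
      "\<lbrakk>x \<in> carrier A; y \<in> carrier A\<rbrakk> \<Longrightarrow> x \<otimes>\<^bsub>A\<^esub> y \<in> carrier A"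
    and mult_add_left:
      "\<lbrakk>x \<in> carrier A; y \<in> carrier A; z \<in> carrier A\<rbrakk> \<Longrightarrow>
        (x \<oplus>\<^bsub>A\<^esub> y) \<otimes>\<^bsub>A\<^esub> z = x \<otimes>\<^bsub>A\<^esub> z \<oplus>\<^bsub>A\<^esub> y \<otimes>\<^bsub>A\<^esub> z"
    and mult_add_right:
      "\<lbrakk>x \<in> carrier A; y \<in> carrier A; z \<in> carrier A\<rbrakk> \<Longrightarrow>
        z \<otimes>\<^bsub>A\<^esub> (x \<oplus>\<^bsub>A\<^esub> y) = z \<otimes>\<^bsub>A\<^esub> x \<oplus>\<^bsub>A\<^esub> z \<otimes>\<^bsub>A\<^esub> y"
    and mult_smult_left:
      "\<lbrakk>a \<in> carrier F; x \<in> carrier A; y \<in> carrier A\<rbrakk> \<Longrightarrow>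
        (a \<odot>\<^bsub>A\<^esub> x) \<otimes>\<^bsub>A\<^esub> y = a \<odot>\<^bsub>A\<^esub> (x \<otimes>\<^bsub>A\<^esub> y)"
    and mult_smult_right:
      "\<lbrakk>a \<in> carrier F; x \<in> carrier A; y \<in> carrier A\<rbrakk> \<Longrightarrow>
        x \<otimes>\<^bsub>A\<^esub> (a \<odot>\<^bsub>A\<^esub> y) = a \<odot>\<^bsub>A\<^esub> (x \<otimes>\<^bsub>A\<^esub> y)"

definition commutative_mult :: "('a, 'b, 'n) module_scheme \<Rightarrow> bool" where
  "commutative_mult A \<longleftrightarrow>
     (\<forall>x\<in>carrier A. \<forall>y\<in>carrier A. x \<otimes>\<^bsub>A\<^esub> y = y \<otimes>\<^bsub>A\<^esub> x)"

definition algebra_ideal ::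
    "('a, 'm) ring_scheme \<Rightarrow> ('a, 'b, 'n) module_scheme \<Rightarrow> 'b set \<Rightarrow> bool" where
  "algebra_ideal F A I \<longleftrightarrow> submodule I F A \<and>
     (\<forall>x\<in>carrier A. \<forall>y\<in>I. x \<otimes>\<^bsub>A\<^esub> y \<in> I \<and> y \<otimes>\<^bsub>A\<^esub> x \<in> I)"

definition simple_algebra ::
    "('a, 'm) ring_scheme \<Rightarrow> ('a, 'b, 'n) module_scheme \<Rightarrow> bool" where
  "simple_algebra F A \<longleftrightarrow> nonassoc_algebra F A \<and>
     (\<exists>x\<in>carrier A. \<exists>y\<in>carrier A. x \<otimes>\<^bsub>A\<^esub> y \<noteq> \<zero>\<^bsub>A\<^esub>) \<and>
     (\<forall>I. algebra_ideal F A I \<longrightarrow> I = {\<zero>\<^bsub>A\<^esub>} \<or> I = carrier A)"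

definition is_identity :: "('a, 'b, 'n) module_scheme \<Rightarrow> 'b \<Rightarrow> bool" where
  "is_identity A u \<longleftrightarrow> u \<in> carrier A \<and>
     (\<forall>x\<in>carrier A. u \<otimes>\<^bsub>A\<^esub> x = x \<and> x \<otimes>\<^bsub>A\<^esub> u = x)"

definition nontrivial_idempotent :: "('a, 'b, 'n) module_scheme \<Rightarrow> 'b \<Rightarrow> bool" where
  "nontrivial_idempotent A e \<longleftrightarrow>
     e \<in> carrier A \<and> e \<otimes>\<^bsub>A\<^esub> e = e \<and> e \<noteq> \<zero>\<^bsub>A\<^esub> \<and> \<not> is_identity A e"

definition linear_iso ::
    "('a, 'm) ring_scheme \<Rightarrow> ('a, 'b, 'n) module_scheme \<Rightarrow> ('a, 'c, 'k) module_scheme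
      \<Rightarrow> ('b \<Rightarrow> 'c) \<Rightarrow> bool" where
  "linear_iso F A B f \<longleftrightarrow> bij_betw f (carrier A) (carrier B) \<and>
     (\<forall>x\<in>carrier A. \<forall>y\<in>carrier A. f (x \<oplus>\<^bsub>A\<^esub> y) = f x \<oplus>\<^bsub>B\<^esub> f y) \<and>
     (\<forall>a\<in>carrier F. \<forall>x\<in>carrier A. f (a \<odot>\<^bsub>A\<^esub> x) = a \<odot>\<^bsub>B\<^esub> f x)"

definition isotopic ::
    "('a, 'm) ring_scheme \<Rightarrow> ('a, 'b, 'n) module_scheme \<Rightarrow> ('a, 'c, 'k) module_scheme
      \<Rightarrow> bool" where
  "isotopic F A B \<longleftrightarrow> nonassoc_algebra F A \<and> nonassoc_algebra F B \<and>
     (\<exists>\<phi> \<psi> \<xi>. linear_iso F A B \<phi> \<and> linear_iso F A B \<psi> \<and> linear_iso F A B \<xi> \<and>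
        (\<forall>a\<in>carrier A. \<forall>b\<in>carrier A. \<phi> a \<otimes>\<^bsub>B\<^esub> \<psi> b = \<xi> (a \<otimes>\<^bsub>A\<^esub> b)))"

(* B ranges over the algebras with elements in the same type as A.  No isotope is lost:
   one with elements in another type is isomorphic, by transport along the inverse
   of \<xi>, to an isotope whose carrier is that of A. *)
definition isotopically_simple ::
    "('a, 'm) ring_scheme \<Rightarrow> ('a, 'b) module \<Rightarrow> bool" where
  "isotopically_simple F A \<longleftrightarrow> nonassoc_algebra F A \<and>
     (\<forall>B :: ('a, 'b) module. isotopic F A B \<longrightarrow> simple_algebra F B)"

end

theory Submission
  imports Defs
begin

text \<open>
  Any field \<open>F\<close> has the split algebra \<open>F \<times> F\<close>, which is visibly not simple: each factor is an
  ideal.  Simplicity can be restored without leaving the isotopy class by exchanging the two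
  coordinates of every product.  On the basis \<open>x\<close>, \<open>y\<close> of orthogonal idempotents of \<open>F \<times> F\<close>
  this gives the commutative product
  \<open>x\<^sup>2 = y\<close>, \<open>y\<^sup>2 = x\<close>, \<open>x y = 0\<close>.  The exchange of coordinates is a linear bijection, so it serves
  as the third map of an isotopy to \<open>F \<times> F\<close> whose first two maps are the identity.

  The new algebra is simple, because a nonzero element \<open>a x + b y\<close> multiplied by \<open>x\<close> or by \<open>y\<close>
  produces a nonzero multiple of a basis vector, and squaring a basis vector produces the other
  one.  The element \<open>x + y\<close> is idempotent, and it is not an identity since it sends \<open>x\<close> to \<open>y\<close>.
\<close>

text \<open>
  Both algebras of the isotopy are instances: \<open>s = id\<close> is the split algebra, and
  \<open>s = (\<lambda>n. 1 - n)\<close> is the one with exchanged coordinates.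
\<close>
definition plane_algebra ::
    "('a, 'm) ring_scheme \<Rightarrow> (nat \<Rightarrow> nat) \<Rightarrow> ('a, nat \<Rightarrow> 'a) module" where
  "plane_algebra F s =
     \<lparr> carrier = {0, 1} \<rightarrow>\<^sub>E carrier F,
       monoid.mult = (\<lambda>v w. \<lambda>n\<in>{0, 1}. v (s n) \<otimes>\<^bsub>F\<^esub> w (s n)),
       one = (\<lambda>n\<in>{0, 1}. \<one>\<^bsub>F\<^esub>),
       ring.zero = (\<lambda>n\<in>{0, 1}. \<zero>\<^bsub>F\<^esub>),
       ring.add = (\<lambda>v w. \<lambda>n\<in>{0, 1}. v n \<oplus>\<^bsub>F\<^esub> w n),
       smult = (\<lambda>a v. \<lambda>n\<in>{0, 1}. a \<otimes>\<^bsub>F\<^esub> v n) \<rparr>"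

lemma plane_algebra_sel:
  "carrier (plane_algebra F s) = {0, 1} \<rightarrow>\<^sub>E carrier F"
  "v \<otimes>\<^bsub>plane_algebra F s\<^esub> w = (\<lambda>n\<in>{0, 1}. v (s n) \<otimes>\<^bsub>F\<^esub> w (s n))"
  "\<zero>\<^bsub>plane_algebra F s\<^esub> = (\<lambda>n\<in>{0, 1}. \<zero>\<^bsub>F\<^esub>)"
  "v \<oplus>\<^bsub>plane_algebra F s\<^esub> w = (\<lambda>n\<in>{0, 1}. v n \<oplus>\<^bsub>F\<^esub> w n)"
  "a \<odot>\<^bsub>plane_algebra F s\<^esub> v = (\<lambda>n\<in>{0, 1}. a \<otimes>\<^bsub>F\<^esub> v n)"
  by (simp_all add: plane_algebra_def)

lemma plane_coord:
  assumes "v \<in> {0, 1::nat} \<rightarrow>\<^sub>E S"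
  shows "v 0 \<in> S" "v (Suc 0) \<in> S"
  using assms by auto

text \<open>
  The rules below speak of \<open>Suc 0\<close>, the form into which simplification brings the index \<open>1\<close>.
\<close>
lemma plane_restrict_eq_iff:
  "(\<lambda>n\<in>{0, Suc 0}. f n) = (\<lambda>n\<in>{0, Suc 0}. g n) \<longleftrightarrow> f 0 = g 0 \<and> f (Suc 0) = g (Suc 0)"
  by (auto simp: fun_eq_iff restrict_def)

lemma plane_restrict_id:
  assumes "v \<in> {0, 1::nat} \<rightarrow>\<^sub>E S" "f 0 = v 0" "f 1 = v 1"
  shows "(\<lambda>n\<in>{0, Suc 0}. f n) = v"
  using assms by (intro PiE_ext[of _ _ "\<lambda>_. S"]) auto

lemmas plane_simps = plane_algebra_sel plane_coord plane_restrict_eq_iff plane_restrict_id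

context field
begin

lemma module_plane_algebra: "module R (plane_algebra R s)"
proof (rule moduleI)
  show "abelian_group (plane_algebra R s)"
  proof (rule abelian_groupI, goal_cases)
    case (6 v)
    let ?w = "\<lambda>n\<in>{0, 1}. \<ominus> v n"
    have "?w \<in> carrier (plane_algebra R s)"
      using 6 by (simp add: plane_algebra_sel plane_coord)
    moreover have "?w \<oplus>\<^bsub>plane_algebra R s\<^esub> v = \<zero>\<^bsub>plane_algebra R s\<^esub>"
      using 6 by (simp add: plane_algebra_sel plane_coord l_neg plane_restrict_eq_iff)
    ultimately show ?case
      by blast
  qed (simp_all add: plane_algebra_sel plane_coord a_ac plane_restrict_eq_iff plane_restrict_id)
qed (simp_all add: plane_algebra_sel plane_coord is_cring l_distr r_distr m_assoc
       plane_restrict_eq_iff plane_restrict_id)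

lemma nonassoc_algebra_plane_algebra:
  assumes "s \<in> {0, 1} \<rightarrow> {0, 1}"
  shows "nonassoc_algebra R (plane_algebra R s)"
proof -
  have s: "s 0 = 0 \<or> s 0 = Suc 0" "s (Suc 0) = 0 \<or> s (Suc 0) = Suc 0"
    using assms by auto
  then have coord: "v (s 0) \<in> carrier R" "v (s (Suc 0)) \<in> carrier R"
    if "v \<in> {0, 1} \<rightarrow>\<^sub>E carrier R" for v
    using that by (auto dest: plane_coord)
  interpret module R "plane_algebra R s" by (rule module_plane_algebra)
  show ?thesis
    by unfold_locales (simp_all add: plane_simps coord s l_distr r_distr m_ac)
qed

lemma commutative_mult_plane_algebra:
  assumes "s \<in> {0, 1} \<rightarrow> {0, 1}"
  shows "commutative_mult (plane_algebra R s)"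
proof -
  have "s 0 = 0 \<or> s 0 = Suc 0" "s (Suc 0) = 0 \<or> s (Suc 0) = Suc 0"
    using assms by auto
  then have "v (s 0) \<in> carrier R" "v (s (Suc 0)) \<in> carrier R"
    if "v \<in> {0, 1} \<rightarrow>\<^sub>E carrier R" for v
    using that by (auto dest: plane_coord)
  then show ?thesis
    by (simp add: commutative_mult_def plane_simps m_comm)
qed

lemma not_simple_split_algebra: "\<not> simple_algebra R (plane_algebra R id)"
proof
  let ?B = "plane_algebra R id"
  let ?I = "{v \<in> carrier ?B. v 0 = \<zero>}"
  assume simple: "simple_algebra R ?B"
  interpret B: module R ?B by (rule module_plane_algebra)
  have "submodule ?I R ?B"
  proof (rule B.submoduleI, goal_cases)
    case (3 v)
    then have v: "v \<in> carrier ?B" "v 0 = \<zero>"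
      by blast+
    let ?w = "\<lambda>n\<in>{0, 1}. \<ominus> v n"
    have "?w \<oplus>\<^bsub>?B\<^esub> v = \<zero>\<^bsub>?B\<^esub>"
      using v by (simp add: plane_simps l_neg)
    moreover note v(1)
    moreover have "?w \<in> carrier ?B"
      using v by (simp add: plane_simps)
    ultimately have "\<ominus>\<^bsub>?B\<^esub> v = ?w"
      by (rule B.M.minus_equality)
    then show ?case
      using v by (simp add: plane_simps)
  next
    case 1
    show ?case by blast
  qed (simp_all add: plane_simps)
  then have "algebra_ideal R ?B ?I"
    by (simp add: algebra_ideal_def plane_simps)
  then have "?I = {\<zero>\<^bsub>?B\<^esub>} \<or> ?I = carrier ?B"
    using simple unfolding simple_algebra_def by blast
  moreover have "(\<lambda>n\<in>{0, 1}. if n = 0 then \<zero> else \<one>) \<in> ?I"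
    by (simp add: plane_simps)
  moreover have "(\<lambda>n\<in>{0, 1}. if n = 0 then \<zero> else \<one>) \<noteq> \<zero>\<^bsub>?B\<^esub>"
    by (simp add: plane_simps)
  moreover have "(\<lambda>n\<in>{0, 1}. \<one>) \<in> carrier ?B" "(\<lambda>n\<in>{0, 1}. \<one>) \<notin> ?I"
    by (simp_all add: plane_simps)
  ultimately show False
    by blast
qed

abbreviation exchanged_algebra :: "('a, nat \<Rightarrow> 'a) module" where
  "exchanged_algebra \<equiv> plane_algebra R (\<lambda>n. 1 - n)"

lemma nonassoc_algebra_exchanged: "nonassoc_algebra R exchanged_algebra"
  by (rule nonassoc_algebra_plane_algebra) auto

text \<open>
  The \<open>i\<close>-th coordinate of an element is isolated by multiplication with the \<open>i\<close>-th basis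
  vector, which also moves it to the other place; dividing by that coordinate and squaring gives
  the whole basis inside any nonzero ideal.
\<close>
lemma simple_exchanged_algebra: "simple_algebra R exchanged_algebra"
proof -
  let ?A = exchanged_algebra
  define u where "u i = (\<lambda>n\<in>{0, 1::nat}. if n = i then \<one> else \<zero>)" for i
  have u: "u i \<in> carrier ?A" for i
    by (simp add: u_def plane_simps)
  have coord_mult: "inv (v i) \<odot>\<^bsub>?A\<^esub> (v \<otimes>\<^bsub>?A\<^esub> u i) = u (1 - i)"
    if "v \<in> carrier ?A" "v i \<in> Units R" "i = 0 \<or> i = 1" for v i
    using that(3)
  proof
    assume "i = 0"
    then show ?thesis
      using that(1,2) by (simp add: u_def plane_simps)
  next
    assume "i = 1"
    then show ?thesis
      using that(1,2) by (simp add: u_def plane_simps)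
  qed
  have u_sq: "u (1 - i) \<otimes>\<^bsub>?A\<^esub> u (1 - i) = u i" if "i = 0 \<or> i = 1" for i
    using that by (elim disjE) (simp_all add: u_def plane_simps)
  have "I = {\<zero>\<^bsub>?A\<^esub>} \<or> I = carrier ?A" if "algebra_ideal R ?A I" for I
  proof -
    have sub: "submodule I R ?A"
      and mult: "\<And>v w. v \<in> carrier ?A \<Longrightarrow> w \<in> I \<Longrightarrow> w \<otimes>\<^bsub>?A\<^esub> v \<in> I"
      using that unfolding algebra_ideal_def by blast+
    note sub_props = module.submoduleE[OF module_plane_algebra sub]
    show ?thesis
    proof (cases "I \<subseteq> {\<zero>\<^bsub>?A\<^esub>}")
      case True
      then show ?thesis
        using sub_props(2) by blast
    next
      case False
      then obtain v where v: "v \<in> I" "v \<noteq> \<zero>\<^bsub>?A\<^esub>"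
        by blast
      then have vA: "v \<in> carrier ?A"
        using sub_props(1) by blast
      have "v 0 \<noteq> \<zero> \<or> v 1 \<noteq> \<zero>"
      proof (rule ccontr)
        assume "\<not> ?thesis"
        then have "(\<lambda>n\<in>{0, Suc 0}. \<zero>) = v"
          using vA by (intro plane_restrict_id[of _ "carrier R"]) (simp_all add: plane_algebra_sel)
        with v(2) show False
          by (simp add: plane_algebra_sel)
      qed
      then obtain i where i: "i = 0 \<or> i = 1" "v i \<noteq> \<zero>"
        by blast
      have "v i \<in> carrier R"
        using i(1) vA by (elim disjE) (simp_all add: plane_simps)
      with i(2) have unit: "v i \<in> Units R"
        by (simp add: field_Units)
      then have "inv (v i) \<odot>\<^bsub>?A\<^esub> (v \<otimes>\<^bsub>?A\<^esub> u i) \<in> I"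
        using v(1) u by (intro sub_props(4) mult Units_inv_closed)
      then have "u (1 - i) \<in> I"
        by (simp only: coord_mult[OF vA unit i(1)])
      moreover from this have "u i \<in> I"
        using mult[OF u] u_sq[OF i(1)] by metis
      ultimately have uI: "u 0 \<in> I" "u 1 \<in> I"
        using i(1) by (elim disjE; simp)+
      have "w \<in> I" if w: "w \<in> carrier ?A" for w
      proof -
        have wR: "w 0 \<in> carrier R" "w 1 \<in> carrier R"
          using w by (simp_all add: plane_simps)
        have "w 0 \<odot>\<^bsub>?A\<^esub> u 0 \<oplus>\<^bsub>?A\<^esub> w 1 \<odot>\<^bsub>?A\<^esub> u 1 = w"
          using w by (simp add: u_def plane_simps)
        moreover have "w 0 \<odot>\<^bsub>?A\<^esub> u 0 \<oplus>\<^bsub>?A\<^esub> w 1 \<odot>\<^bsub>?A\<^esub> u 1 \<in> I"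
          using wR uI by (intro sub_props(4,5))
        ultimately show ?thesis
          by simp
      qed
      then show ?thesis
        using sub_props(1) by blast
    qed
  qed
  moreover have "u 0 \<otimes>\<^bsub>?A\<^esub> u 0 \<noteq> \<zero>\<^bsub>?A\<^esub>"
    by (simp add: u_def plane_simps)
  ultimately show ?thesis
    using u nonassoc_algebra_exchanged unfolding simple_algebra_def by blast
qed

lemma nontrivial_idempotent_exchanged:
  "nontrivial_idempotent exchanged_algebra (\<lambda>n\<in>{0, 1}. \<one>)"
proof -
  let ?A = exchanged_algebra
  let ?e = "\<lambda>n\<in>{0, 1::nat}. \<one>"
  let ?x = "\<lambda>n\<in>{0, 1::nat}. if n = 0 then \<one> else \<zero>"
  have "?x \<in> carrier ?A" "?e \<otimes>\<^bsub>?A\<^esub> ?x \<noteq> ?x"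
    by (simp_all add: plane_simps)
  then have "\<not> is_identity ?A ?e"
    unfolding is_identity_def by blast
  then show ?thesis
    by (simp add: nontrivial_idempotent_def plane_simps)
qed

lemma isotopic_exchanged_split: "isotopic R exchanged_algebra (plane_algebra R id)"
proof -
  let ?A = exchanged_algebra and ?B = "plane_algebra R id"
  let ?swap = "\<lambda>v. \<lambda>n\<in>{0, 1::nat}. v (1 - n)"
  have id: "linear_iso R ?A ?B id"
    by (simp add: linear_iso_def plane_algebra_sel)
  have swap: "linear_iso R ?A ?B ?swap"
  proof -
    have "?swap v \<in> {0, 1} \<rightarrow>\<^sub>E carrier R" "?swap (?swap v) = v"
      if "v \<in> {0, 1} \<rightarrow>\<^sub>E carrier R" for v
      using that by (simp_all add: plane_simps)
    then have "bij_betw ?swap ({0, 1} \<rightarrow>\<^sub>E carrier R) ({0, 1} \<rightarrow>\<^sub>E carrier R)"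
      by (intro bij_betw_byWitness[where f' = ?swap]) blast+
    then show ?thesis
      by (simp add: linear_iso_def plane_simps)
  qed
  have mult: "id v \<otimes>\<^bsub>?B\<^esub> id w = ?swap (v \<otimes>\<^bsub>?A\<^esub> w)" for v w
    by (simp add: plane_simps)
  have "nonassoc_algebra R ?B"
    by (rule nonassoc_algebra_plane_algebra) auto
  then show ?thesis
    unfolding isotopic_def using nonassoc_algebra_exchanged id swap mult
    by (intro conjI exI[of _ id] exI[of _ ?swap] ballI)
qed

end

theorem mainTheorem5:
  fixes F :: "('a, 'm) ring_scheme"
  assumes "algebraically_closed F"
    and "ring_char F \<noteq> 2"
  shows "\<exists>A :: ('a, nat \<Rightarrow> 'a) module.
           simple_algebra F A \<and> commutative_mult A \<and>
           (\<exists>e. nontrivial_idempotent A e) \<and>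
           \<not> isotopically_simple F A"
proof -
  interpret algebraically_closed F by (rule assms(1))
  have "commutative_mult exchanged_algebra"
    by (rule commutative_mult_plane_algebra) auto
  moreover have "\<not> isotopically_simple F exchanged_algebra"
    using isotopic_exchanged_split not_simple_split_algebra
    by (auto simp: isotopically_simple_def)
  ultimately show ?thesis
    using simple_exchanged_algebra nontrivial_idempotent_exchanged by blast
qed

end
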